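(* Let $(S,N)$ be a normalisation mod $\underline{1}$ (with $\underline{1}\in S$ the $N$-neutral element) for a monoid $M$, and assume that $M$ is left-cancellative and contains no nontrivial invertible element. Then the following are equivalent: (i) $S$ is a Garside family in $M$ and $(S,N)$ is the normalisation derived from $S$; (ii) $(S,N)$ is quadratic of class $(4,3)$ and left-weighted.
   Context: For a set $S$, $S^*$ is the free monoid of words over $S$, $\|w\|$ is word length, $u|v$ is concatenation, $S^{[p]}$ is the set of words of length $p$. A normalisation is a pair $(S,N)$ with $N:S^*\to S^*$ such that for all words $u,v,w$: $\|N(w)\|=\|w\|$; $\|w\|=1$ implies $N(w)=w$; $N(u|N(w)|v)=N(u|w|v)$. A word is $N$-normal if $N(w)=w$. $\overline{N}$ is the restriction of $N$ to $S^{[2]}$, $\overline{N}_i$ applies $\overline{N}$ to entries in positions $i,i+1$, and $\overline{N}_{i_1\cdots i_n}=\overline{N}_{i_n}\circ\cdots\circ\overline{N}_{i_1}$. $(S,N)$ is quadratic if (a) a word is $N$-normal iff each of its length-two factors is, and (b) for every word $w$ there is a finite sequence $u$ of positions with $N(w)=\overline{N}_u(w)$. It is of class $(4,3)$ if moreover $N(w)=\overline{N}_{1212}(w)=\overline{N}_{212}(w)$ for all $w\in S^{[3]}$. An element $e\in S$ is $N$-neutral if $N(w|e)=N(e|w)=N(w)|e$ for every word $w$. $(S,N)$ is a normalisation mod $e$ for a monoid $M$ if $e$ is $N$-neutral and $M$ is presented by generators $S$ and relations $\{w=N(w): w\in S^*\}\cup\{e=1\}$. In this case the canonical map $S\to M$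 is injective and sends $e$ to $1$, and $S$ is identified with its image, a subset of $M$ containing $1$ (so the letter $\underline{1}$ is identified with $1\in M$). For $f,g\in M$, $f\preccurlyeq g$ (left-divisibility) means $fg'=g$ for some $g'\in M$. $(S,N)$ is left-weighted if for all $s,t,s',t'\in S$, $s'|t'=N(s|t)$ implies $s\preccurlyeq s'$ in $M$. For $M$ left-cancellative and $S\subseteq M$, a word $s_1|s_2$ over $S$ is $S$-normal if for all $s\in S$ and $f\in M$, $s\preccurlyeq f s_1s_2$ implies $s\preccurlyeq f s_1$; a word $s_1|\cdots|s_p$ is $S$-normal if every $s_i|s_{i+1}$ is. If $M$ has no nontrivial invertible element and $1\in S\subseteq M$, then $S$ is a Garside family in $M$ if every $g\in M$ is equal to $s_1\cdots s_p$ for some $S$-normal word $s_1|\cdots|s_p$. In that case (known) each $g\in M$ has a unique $S$-normal decomposition $\mathrm{NF}(g)$ of minimal length (a word over $S\setminus\{1\}$), and if $g$ is represented by a word $w$ over $S$ then $\|\mathrm{NF}(g)\|\le\|w\|$. The normalisation derived from $S$ is $(S,N)$ with $N(w)=\mathrm{NF}(g)|1^m$, where $g\in M$ is the evaluation of $w$ and $m=\|w\|-\|\mathrm{NF}(g)\|$. *)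

theory Defs
  imports "HOL-Algebra.Divisibility"
begin

text \<open>
  Words over \<open>S\<close> are the elements of \<open>lists S\<close>. A normalisation is a pair \<open>(S, N)\<close> in which
  only the restriction of \<open>N\<close> to \<open>lists S\<close> matters.
\<close>

definition normalisation :: "'a set \<Rightarrow> ('a list \<Rightarrow> 'a list) \<Rightarrow> bool" where
  "normalisation S N \<longleftrightarrow>
     (\<forall>w\<in>lists S. N w \<in> lists S) \<and>
     (\<forall>w\<in>lists S. length (N w) = length w) \<and>
     (\<forall>w\<in>lists S. length w = 1 \<longrightarrow> N w = w) \<and>
     (\<forall>u\<in>lists S. \<forall>v\<in>lists S. \<forall>w\<in>lists S. N (u @ N w @ v) = N (u @ w @ v))"

text \<open>
  Positions are counted from 1. The value of \<open>Nbar N i w\<close> is meaningful only if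
  \<open>1 \<le> i < length w\<close>.
\<close>

definition Nbar :: "('a list \<Rightarrow> 'a list) \<Rightarrow> nat \<Rightarrow> 'a list \<Rightarrow> 'a list" where
  "Nbar N i w = take (i - 1) w @ N [w ! (i - 1), w ! i] @ drop (i + 1) w"

text \<open>The leftmost position of the sequence is applied first.\<close>

definition Nbar_seq :: "('a list \<Rightarrow> 'a list) \<Rightarrow> nat list \<Rightarrow> 'a list \<Rightarrow> 'a list" where
  "Nbar_seq N is w = fold (Nbar N) is w"

definition quadratic :: "'a set \<Rightarrow> ('a list \<Rightarrow> 'a list) \<Rightarrow> bool" where
  "quadratic S N \<longleftrightarrow>
     (\<forall>w\<in>lists S. N w = w \<longleftrightarrow> (\<forall>u s t v. w = u @ [s, t] @ v \<longrightarrow> N [s, t] = [s, t])) \<and>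
     (\<forall>w\<in>lists S. \<exists>is. (\<forall>i\<in>set is. 1 \<le> i \<and> i < length w) \<and> N w = Nbar_seq N is w)"

definition quadratic_class_4_3 :: "'a set \<Rightarrow> ('a list \<Rightarrow> 'a list) \<Rightarrow> bool" where
  "quadratic_class_4_3 S N \<longleftrightarrow>
     quadratic S N \<and>
     (\<forall>w\<in>lists S. length w = 3 \<longrightarrow>
        N w = Nbar_seq N [1, 2, 1, 2] w \<and> N w = Nbar_seq N [2, 1, 2] w)"

definition neutral :: "'a set \<Rightarrow> ('a list \<Rightarrow> 'a list) \<Rightarrow> 'a \<Rightarrow> bool" where
  "neutral S N e \<longleftrightarrow>
     e \<in> S \<and> (\<forall>w\<in>lists S. N (w @ [e]) = N w @ [e] \<and> N ([e] @ w) = N w @ [e])"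

definition word_eval :: "('a, 'b) monoid_scheme \<Rightarrow> 'a list \<Rightarrow> 'a" where
  "word_eval M w = foldr (\<otimes>\<^bsub>M\<^esub>) w \<one>\<^bsub>M\<^esub>"

text \<open>The congruence on the free monoid \<open>lists S\<close> generated by the relations \<open>R\<close>.\<close>

inductive word_cong :: "'a set \<Rightarrow> ('a list \<times> 'a list) set \<Rightarrow> 'a list \<Rightarrow> 'a list \<Rightarrow> bool"
  for S R where
  base: "(u, v) \<in> R \<Longrightarrow> u \<in> lists S \<Longrightarrow> v \<in> lists S \<Longrightarrow> word_cong S R u v"
| refl: "u \<in> lists S \<Longrightarrow> word_cong S R u u"
| sym: "word_cong S R u v \<Longrightarrow> word_cong S R v u"
| trans: "word_cong S R u v \<Longrightarrow> word_cong S R v w \<Longrightarrow> word_cong S R u w"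
| ctxt: "word_cong S R u v \<Longrightarrow> x \<in> lists S \<Longrightarrow> y \<in> lists S \<Longrightarrow> word_cong S R (x @ u @ y) (x @ v @ y)"

text \<open>
  \<open>M\<close> is presented by the generators \<open>S\<close> and the relations \<open>R\<close>, the canonical map from \<open>S\<close> to
  \<open>M\<close> being the inclusion: evaluation of words is onto, and its kernel is the congruence
  generated by \<open>R\<close>.
\<close>

definition presented_by ::
    "('a, 'b) monoid_scheme \<Rightarrow> 'a set \<Rightarrow> ('a list \<times> 'a list) set \<Rightarrow> bool" where
  "presented_by M S R \<longleftrightarrow>
     S \<subseteq> carrier M \<and>
     word_eval M ` lists S = carrier M \<and>
     (\<forall>u\<in>lists S. \<forall>v\<in>lists S. word_eval M u = word_eval M v \<longleftrightarrow> word_cong S R u v)"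

text \<open>
  The canonical map from \<open>S\<close> to a monoid for which \<open>(S, N)\<close> is a normalisation mod \<open>e\<close> is
  always injective; \<open>S\<close> is identified with its image in \<open>M\<close>, so that \<open>e\<close> is the unit of \<open>M\<close>.
\<close>

definition normalisation_mod ::
    "'a set \<Rightarrow> ('a list \<Rightarrow> 'a list) \<Rightarrow> 'a \<Rightarrow> ('a, 'b) monoid_scheme \<Rightarrow> bool" where
  "normalisation_mod S N e M \<longleftrightarrow>
     normalisation S N \<and> neutral S N e \<and>
     presented_by M S ({(w, N w) | w. w \<in> lists S} \<union> {([e], [])})"

definition left_cancellative :: "('a, 'b) monoid_scheme \<Rightarrow> bool" where
  "left_cancellative M \<longleftrightarrow>
     (\<forall>f\<in>carrier M. \<forall>g\<in>carrier M. \<forall>h\<in>carrier M. f \<otimes>\<^bsub>M\<^esub> g = f \<otimes>\<^bsub>M\<^esub> h \<longrightarrow> g = h)"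

text \<open>
  Since \<open>a divides\<^bsub>M\<^esub> b\<close> means \<open>\<exists>c\<in>carrier M. b = a \<otimes>\<^bsub>M\<^esub> c\<close>, it is left-divisibility when
  \<open>M\<close> is not commutative.
\<close>

definition left_weighted ::
    "'a set \<Rightarrow> ('a list \<Rightarrow> 'a list) \<Rightarrow> ('a, 'b) monoid_scheme \<Rightarrow> bool" where
  "left_weighted S N M \<longleftrightarrow>
     (\<forall>s\<in>S. \<forall>t\<in>S. \<forall>s'\<in>S. \<forall>t'\<in>S. [s', t'] = N [s, t] \<longrightarrow> s divides\<^bsub>M\<^esub> s')"

definition normal_pair :: "('a, 'b) monoid_scheme \<Rightarrow> 'a set \<Rightarrow> 'a \<Rightarrow> 'a \<Rightarrow> bool" where
  "normal_pair M S s1 s2 \<longleftrightarrow>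
     (\<forall>s\<in>S. \<forall>f\<in>carrier M.
        s divides\<^bsub>M\<^esub> (f \<otimes>\<^bsub>M\<^esub> s1 \<otimes>\<^bsub>M\<^esub> s2) \<longrightarrow> s divides\<^bsub>M\<^esub> (f \<otimes>\<^bsub>M\<^esub> s1))"

definition normal_word :: "('a, 'b) monoid_scheme \<Rightarrow> 'a set \<Rightarrow> 'a list \<Rightarrow> bool" where
  "normal_word M S w \<longleftrightarrow> w \<in> lists S \<and> successively (normal_pair M S) w"

text \<open>
  The following three definitions are meant for left-cancellative \<open>M\<close> without nontrivial
  invertible elements.
\<close>

definition garside_family :: "('a, 'b) monoid_scheme \<Rightarrow> 'a set \<Rightarrow> bool" where
  "garside_family M S \<longleftrightarrow>
     \<one>\<^bsub>M\<^esub> \<in> S \<and> S \<subseteq> carrier M \<and>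
     (\<forall>g\<in>carrier M. \<exists>w. normal_word M S w \<and> word_eval M w = g)"

text \<open>
  If \<open>S\<close> is a Garside family, every element of \<open>M\<close> has exactly one normal decomposition of
  minimal length.
\<close>

definition NF :: "('a, 'b) monoid_scheme \<Rightarrow> 'a set \<Rightarrow> 'a \<Rightarrow> 'a list" where
  "NF M S g =
     (THE w. normal_word M S w \<and> word_eval M w = g \<and>
        (\<forall>v. normal_word M S v \<and> word_eval M v = g \<longrightarrow> length w \<le> length v))"

text \<open>The natural number subtraction does not truncate if \<open>S\<close> is a Garside family.\<close>

definition derived_normalisation ::
    "('a, 'b) monoid_scheme \<Rightarrow> 'a set \<Rightarrow> 'a list \<Rightarrow> 'a list" where
  "derived_normalisation M S w =
     NF M S (word_eval M w) @
     replicate (length w - length (NF M S (word_eval M w))) \<one>\<^bsub>M\<^esub>"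

end

theory Submission
  imports Defs
begin

text \<open>
  Both directions rest on the domino rule: if \<open>t|u\<close> is normal and \<open>r|g\<close> is the normal form of
  \<open>s|t\<close>, then \<open>r\<close> followed by the first letter of the normal form of \<open>g|u\<close> is normal. It lets
  one multiply a normal word on the left by a letter in a single pass from left to right.
  For a Garside family the rule follows from greediness, which gives quadraticity and the class
  \<open>(4,3)\<close>. Conversely the class \<open>(4,3)\<close> gives the rule, so that the first letter of \<open>N(s|w)\<close>,
  with \<open>w\<close> normal, depends only on \<open>s\<close> and on the first letter of \<open>w\<close>; hence \<open>N(u|a|b)\<close> and
  \<open>N(u|a)\<close> have the same first letter when \<open>a|b\<close> is normal. Since left-weightedness makes the
  first letter of \<open>N(w)\<close> a multiple of every letter of \<open>S\<close> that left-divides the evaluation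
  of \<open>w\<close>, normal words are greedy.
\<close>

section \<open>Words, rewriting at positions, and evaluation\<close>

text \<open>Turns the factor condition in \<open>quadratic\<close> into a recursion along the word,
  the form in which both directions use it.\<close>

lemma successively_iff_factors:
  "successively P w \<longleftrightarrow> (\<forall>u s t v. w = u @ [s, t] @ v \<longrightarrow> P s t)"
proof
  assume "successively P w"
  then show "\<forall>u s t v. w = u @ [s, t] @ v \<longrightarrow> P s t"
    by (auto simp: successively_append_iff)
next
  assume "\<forall>u s t v. w = u @ [s, t] @ v \<longrightarrow> P s t"
  then show "successively P w"
  proof (induction w rule: induct_list012)
    case (3 a b w)
    have "P a b"
      using 3(3)[rule_format, of "[]" a b w] by simp
    moreover have "P s t" if "b # w = u @ [s, t] @ v" for u s t v
      using 3(3)[rule_format, of "a # u" s t v] that by simp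
    ultimately show ?case
      using 3(2) by simp
  qed auto
qed

lemma Nbar_1: "Nbar N (Suc 0) (a # b # w) = N [a, b] @ w"
  by (simp add: Nbar_def)

lemma Nbar_Suc_Cons: "1 \<le> i \<Longrightarrow> Nbar N (Suc i) (a # w) = a # Nbar N i w"
  by (cases i) (auto simp: Nbar_def)

lemma Nbar_seq_Nil [simp]: "Nbar_seq N [] w = w"
  by (simp add: Nbar_seq_def)

lemma Nbar_seq_Cons [simp]: "Nbar_seq N (i # is) w = Nbar_seq N is (Nbar N i w)"
  by (simp add: Nbar_seq_def)

lemma Nbar_seq_append: "Nbar_seq N (is @ js) w = Nbar_seq N js (Nbar_seq N is w)"
  by (simp add: Nbar_seq_def)

lemma Nbar_seq_map_Suc:
  "\<forall>i\<in>set is. 1 \<le> i \<Longrightarrow> Nbar_seq N (map Suc is) (a # w) = a # Nbar_seq N is w"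
  by (induction "is" arbitrary: w) (auto simp: Nbar_Suc_Cons)

lemma word_eval_Nil [simp]: "word_eval M [] = \<one>\<^bsub>M\<^esub>"
  by (simp add: word_eval_def)

lemma word_eval_Cons [simp]: "word_eval M (a # w) = a \<otimes>\<^bsub>M\<^esub> word_eval M w"
  by (simp add: word_eval_def)

context monoid
begin

lemma word_eval_closed [intro, simp]: "set w \<subseteq> carrier G \<Longrightarrow> word_eval G w \<in> carrier G"
  by (induction w) auto

lemma word_eval_append:
  "set u \<subseteq> carrier G \<Longrightarrow> set v \<subseteq> carrier G \<Longrightarrow> word_eval G (u @ v) = word_eval G u \<otimes> word_eval G v"
  by (induction u) (auto simp: m_assoc)

lemma word_eval_replicate_one [simp]: "word_eval G (replicate n \<one>) = \<one>"
  by (induction n) auto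

end

section \<open>Standing hypotheses and basic properties of the normalisation\<close>

locale cancellative_normalisation = monoid M for M :: "('a, 'b) monoid_scheme" (structure) +
  fixes S :: "'a set" and N :: "'a list \<Rightarrow> 'a list"
  assumes norm_mod: "normalisation_mod S N \<one> M"
    and canc: "left_cancellative M"
    and units: "Units M = {\<one>}"
begin

lemma S_carrier: "s \<in> S \<Longrightarrow> s \<in> carrier M"
  and one_S [simp]: "\<one> \<in> S"
  using norm_mod by (auto simp: normalisation_mod_def presented_by_def neutral_def)

lemma lists_carrier: "w \<in> lists S \<Longrightarrow> set w \<subseteq> carrier M"
  using S_carrier by auto

lemma N_lists [simp]: "w \<in> lists S \<Longrightarrow> N w \<in> lists S"
  and N_length [simp]: "w \<in> lists S \<Longrightarrow> length (N w) = length w"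
  and N_inner: "u \<in> lists S \<Longrightarrow> v \<in> lists S \<Longrightarrow> w \<in> lists S \<Longrightarrow> N (u @ N w @ v) = N (u @ w @ v)"
  and N_letter: "a \<in> S \<Longrightarrow> N [a] = [a]"
  and N_snoc_one: "w \<in> lists S \<Longrightarrow> N (w @ [\<one>]) = N w @ [\<one>]"
  and N_Cons_one: "w \<in> lists S \<Longrightarrow> N (\<one> # w) = N w @ [\<one>]"
  using norm_mod by (auto simp: normalisation_mod_def normalisation_def neutral_def)

lemma N_eq_Nil_iff [simp]: "w \<in> lists S \<Longrightarrow> N w = [] \<longleftrightarrow> w = []"
  by (metis N_length length_0_conv)

lemma N_idem: "w \<in> lists S \<Longrightarrow> N (N w) = N w"
  using N_inner[of "[]" "[]" w] by simp

lemma N_Cons: "a \<in> S \<Longrightarrow> w \<in> lists S \<Longrightarrow> N (a # N w) = N (a # w)"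
  using N_inner[of "[a]" "[]" w] by simp

lemma N_pair_obtain:
  assumes "a \<in> S" "b \<in> S"
  obtains r g where "N [a, b] = [r, g]" "r \<in> S" "g \<in> S"
proof -
  have "length (N [a, b]) = 2" "N [a, b] \<in> lists S"
    using assms by auto
  then obtain r g where "N [a, b] = [r, g]"
    by (auto simp: numeral_2_eq_2 length_Suc_conv)
  with \<open>N [a, b] \<in> lists S\<close> that show thesis by simp
qed

lemma N_pair_prefix:
  assumes "a \<in> S" "b \<in> S" "w \<in> lists S" "N [a, b] = [r, g]"
  shows "N (r # g # w) = N (a # b # w)"
  using N_inner[of "[]" w "[a, b]"] assms by simp

lemma word_eval_N:
  assumes "w \<in> lists S"
  shows "word_eval M (N w) = word_eval M w"
proof -
  let ?R = "{(w, N w) | w. w \<in> lists S} \<union> {([\<one>], [])}"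
  have "word_cong S ?R w (N w)"
    using assms by (intro word_cong.base) auto
  moreover have "word_eval M w = word_eval M (N w) \<longleftrightarrow> word_cong S ?R w (N w)"
    using norm_mod assms N_lists[OF assms]
    unfolding normalisation_mod_def presented_by_def by blast
  ultimately show ?thesis by simp
qed

lemma word_eval_surj:
  assumes "f \<in> carrier M"
  obtains w where "w \<in> lists S" "word_eval M w = f"
proof -
  have "f \<in> word_eval M ` lists S"
    using norm_mod assms by (simp add: normalisation_mod_def presented_by_def)
  then show thesis using that by blast
qed

section \<open>Padding by ones and equality in the monoid\<close>

lemma one_pad_lists [simp]: "replicate m \<one> \<in> lists S"
  by (induction m) auto

lemma N_append_ones: "w \<in> lists S \<Longrightarrow> N (w @ replicate m \<one>) = N w @ replicate m \<one>"
proof (induction m)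
  case (Suc m)
  have "N ((w @ replicate m \<one>) @ [\<one>]) = N (w @ replicate m \<one>) @ [\<one>]"
    using Suc.prems by (intro N_snoc_one) auto
  then show ?case
    using Suc by (simp add: replicate_append_same)
qed simp

lemma N_prepend_ones: "w \<in> lists S \<Longrightarrow> N (replicate m \<one> @ w) = N w @ replicate m \<one>"
proof (induction m)
  case (Suc m)
  have "N (\<one> # (replicate m \<one> @ w)) = N (replicate m \<one> @ w) @ [\<one>]"
    using Suc.prems by (intro N_Cons_one) auto
  then show ?case
    using Suc by (simp add: replicate_append_same)
qed simp

text \<open>Both \<open>replicate m \<one> @ w\<close> and \<open>w @ replicate m \<one>\<close>
  have the normal form \<open>N w @ replicate m \<one>\<close>, so a block of ones can be moved to
  the right end, where it splits off.\<close>

lemma N_inner_ones: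
  assumes "u \<in> lists S" "w \<in> lists S"
  shows "N (u @ replicate m \<one> @ w) = N (u @ w) @ replicate m \<one>"
proof -
  have "N (u @ replicate m \<one> @ w) = N (u @ N (replicate m \<one> @ w) @ [])"
    using assms N_inner[of u "[]" "replicate m \<one> @ w"] by auto
  also have "\<dots> = N (u @ N (w @ replicate m \<one>) @ [])"
    using assms by (simp add: N_prepend_ones N_append_ones)
  also have "\<dots> = N ((u @ w) @ replicate m \<one>)"
    using assms N_inner[of u "[]" "w @ replicate m \<one>"] by auto
  also have "\<dots> = N (u @ w) @ replicate m \<one>"
    using assms by (intro N_append_ones) auto
  finally show ?thesis .
qed

text \<open>The relation that identifies the letter 1 with the empty word changes the length, so
  normal forms are invariant under the congruence only up to trailing ones.\<close>

lemma word_cong_imp_N_eq: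
  assumes "word_cong S ({(w, N w) | w. w \<in> lists S} \<union> {([\<one>], [])}) u v"
  shows "u \<in> lists S \<and> v \<in> lists S \<and>
    (\<exists>m n. N u @ replicate m \<one> = N v @ replicate n \<one>)"
  using assms
proof induction
  case (base u v)
  then show ?case
  proof (elim UnE)
    assume "(u, v) \<in> {([\<one>], [])}"
    then have "N u @ replicate 0 \<one> = N v @ replicate 1 \<one>"
      using N_snoc_one[of "[]"] by simp
    with base show ?thesis by blast
  qed (auto simp: N_idem intro!: exI[of _ 0])
next
  case (trans u v w)
  then obtain m n k l where
    "N u @ replicate m \<one> = N v @ replicate n \<one>" "N v @ replicate k \<one> = N w @ replicate l \<one>"
    by blast
  \<comment> \<open>Each equation is padded by the ones of the other, so that both pass through
    \<open>N v\<close> followed by \<open>n + k\<close> ones.\<close>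
  then have "N u @ replicate m \<one> @ replicate k \<one> = N w @ replicate l \<one> @ replicate n \<one>"
    by (metis append.assoc add.commute replicate_add)
  then have "N u @ replicate (m + k) \<one> = N w @ replicate (l + n) \<one>"
    by (simp add: replicate_add)
  with trans show ?case by blast
next
  case (ctxt u v x y)
  then obtain m n where eq: "N u @ replicate m \<one> = N v @ replicate n \<one>" by blast
  \<comment> \<open>Ones trailing \<open>N u\<close> inside the context move out to the end; the
    equation \<open>eq\<close> can then be applied inside the context.\<close>
  have pad: "N (x @ u @ y) @ replicate m \<one> = N (x @ (N u @ replicate m \<one>) @ y)"
    if "u \<in> lists S" for u m
  proof -
    have "N (x @ (N u @ replicate m \<one>) @ y) = N (x @ (u @ replicate m \<one>) @ y)"
      using that ctxt N_inner[of x y "u @ replicate m \<one>"] by (simp add: N_append_ones)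
    then show ?thesis
      using that ctxt N_inner_ones[of "x @ u" y m] by simp
  qed
  have S: "u \<in> lists S" "v \<in> lists S"
    using ctxt.IH by auto
  have "N (x @ u @ y) @ replicate m \<one> = N (x @ v @ y) @ replicate n \<one>"
    unfolding pad[OF S(1)] pad[OF S(2)] eq ..
  moreover have "x @ u @ y \<in> lists S" "x @ v @ y \<in> lists S"
    using S ctxt.hyps by auto
  ultimately show ?case by blast
qed (metis)+

lemma word_eval_eq_imp_N_eq:
  assumes "u \<in> lists S" "v \<in> lists S" "word_eval M u = word_eval M v"
  shows "\<exists>m n. N u @ replicate m \<one> = N v @ replicate n \<one>"
proof -
  have "word_cong S ({(w, N w) | w. w \<in> lists S} \<union> {([\<one>], [])}) u v"
    using norm_mod assms unfolding normalisation_mod_def presented_by_def by blast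
  then show ?thesis using word_cong_imp_N_eq by blast
qed

section \<open>Greedy words: uniqueness and the normal form \<open>NF\<close>\<close>

text \<open>If \<open>b = a \<otimes> c\<close> and \<open>a = b \<otimes> d\<close>, cancelling
  \<open>a\<close> gives \<open>c \<otimes> d = \<one>\<close>, and cancelling \<open>c\<close> in
  \<open>c \<otimes> d \<otimes> c = c\<close> gives \<open>d \<otimes> c = \<one>\<close>. So
  \<open>c\<close> is invertible, hence 1.\<close>

lemma divides_antisym:
  assumes "a \<in> carrier M" "b \<in> carrier M" "a divides b" "b divides a"
  shows "a = b"
proof -
  obtain c d where c: "c \<in> carrier M" "b = a \<otimes> c" and d: "d \<in> carrier M" "a = b \<otimes> d"
    using assms by (auto simp: factor_def)
  have "a \<otimes> (c \<otimes> d) = b \<otimes> d"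
    unfolding c(2) using assms(1) c(1) d(1) by (simp add: m_assoc)
  also have "\<dots> = a \<otimes> \<one>"
    using assms(1) d(2) by simp
  finally have eq: "a \<otimes> (c \<otimes> d) = a \<otimes> \<one>" .
  have cd: "c \<otimes> d = \<one>"
    using eq canc assms(1) c(1) d(1) unfolding left_cancellative_def by (meson m_closed one_closed)
  have "c \<otimes> (d \<otimes> c) = c \<otimes> \<one>"
    using c(1) d(1) cd by (simp flip: m_assoc)
  then have "d \<otimes> c = \<one>"
    using canc c(1) d(1) unfolding left_cancellative_def by (meson m_closed one_closed)
  with cd c(1) d(1) have "c \<in> Units M"
    by (auto simp: Units_def)
  then have "c = \<one>"
    using units by simp
  then show ?thesis
    using assms(1) c(2) by simp
qed

text \<open>Greediness passes from pairs to words: absorb the first letter into \<open>f\<close>,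
  apply induction to the tail, then use the first pair. This is why \<open>f\<close> is arbitrary in
  the induction.\<close>

lemma normal_word_head:
  assumes "normal_word M S (b # w)" "a \<in> S" "f \<in> carrier M"
    and "a divides f \<otimes> word_eval M (b # w)"
  shows "a divides f \<otimes> b"
  using assms
proof (induction w arbitrary: b f)
  case Nil
  then show ?case by (simp add: normal_word_def S_carrier)
next
  case (Cons c w)
  then have carr: "b \<in> carrier M" "c \<in> carrier M" "set w \<subseteq> carrier M"
    using S_carrier by (auto simp: normal_word_def)
  have tail: "normal_word M S (c # w)" and pair: "normal_pair M S b c"
    using Cons.prems(1) by (auto simp: normal_word_def)
  have fb: "f \<otimes> b \<in> carrier M"
    using Cons.prems(3) carr by simp
  have "a divides (f \<otimes> b) \<otimes> word_eval M (c # w)"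
    using Cons.prems carr by (simp add: m_assoc)
  from Cons.IH[OF tail Cons.prems(2) fb this] have "a divides f \<otimes> b \<otimes> c" .
  then show ?case
    using pair Cons.prems(2,3) unfolding normal_pair_def by blast
qed

text \<open>Greediness with \<open>f = \<one>\<close> makes the two first letters divide each other,
  so they agree and can be cancelled. Equal lengths are required because trailing ones change
  neither normality nor value.\<close>

lemma normal_word_unique:
  assumes "length u = length v" "normal_word M S u" "normal_word M S v"
    and "word_eval M u = word_eval M v"
  shows "u = v"
  using assms
proof (induction u v rule: list_induct2)
  case (Cons a u b v)
  have S: "a \<in> S" "b \<in> S" "u \<in> lists S" "v \<in> lists S"
    using Cons.prems by (auto simp: normal_word_def)
  note carr = S(1,2)[THEN S_carrier] S(3,4)[THEN lists_carrier]
  have "a divides a \<otimes> word_eval M u" "b divides b \<otimes> word_eval M v"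
    using carr by auto
  then have "a divides \<one> \<otimes> word_eval M (b # v)" "b divides \<one> \<otimes> word_eval M (a # u)"
    using Cons.prems(3) carr by simp_all
  then have "a divides b" "b divides a"
    using normal_word_head[of b v a \<one>] normal_word_head[of a u b \<one>] Cons.prems S carr by auto
  then have "a = b"
    using divides_antisym carr by blast
  moreover have "word_eval M u = word_eval M v"
    using canc carr Cons.prems \<open>a = b\<close> unfolding left_cancellative_def
    by (metis word_eval_Cons word_eval_closed)
  moreover have "normal_word M S u" "normal_word M S v"
    using Cons.prems by (auto simp: normal_word_def successively_Cons)
  ultimately show ?case
    using Cons.IH by simp
qed simp

text \<open>Every pair \<open>a\<close>, 1 is normal, since
  \<open>f \<otimes> a \<otimes> \<one> = f \<otimes> a\<close>.\<close>

lemma normal_word_append_ones: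
  assumes "normal_word M S w"
  shows "normal_word M S (w @ replicate m \<one>)"
proof -
  have np: "normal_pair M S a \<one>" if "a \<in> S" for a
    using S_carrier[OF that] by (auto simp: normal_pair_def)
  have "successively (normal_pair M S) (replicate m \<one>)"
    by (induction m) (auto simp: successively_Cons np, metis hd_replicate np one_S)
  moreover have "normal_pair M S (last w) \<one>" if "w \<noteq> []"
    using assms that by (auto simp: normal_word_def intro: np)
  ultimately show ?thesis
    using assms by (cases m) (auto simp: normal_word_def successively_append_iff np)
qed

text \<open>Justifies the definite description in \<open>NF\<close>: a shortest normal word exists
  as soon as some normal word \<open>w\<close> does, and two shortest ones have equal length, hence
  coincide. Padding it to the length of \<open>w\<close> gives \<open>w\<close> itself, by
  uniqueness again.\<close>

lemma NF_normal:
  assumes "normal_word M S w"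
  defines "y \<equiv> NF M S (word_eval M w)"
  shows "normal_word M S y \<and> word_eval M y = word_eval M w \<and>
    w = y @ replicate (length w - length y) \<one>"
proof -
  let ?Q = "\<lambda>v. normal_word M S v \<and> word_eval M v = word_eval M w"
  let ?P = "\<lambda>v. normal_word M S v \<and> word_eval M v = word_eval M w \<and>
     (\<forall>v'. normal_word M S v' \<and> word_eval M v' = word_eval M w \<longrightarrow> length v \<le> length v')"
  have Q: "?Q w" using assms by simp
  have "?P (arg_min length ?Q)"
    using arg_min_nat_lemma[of ?Q, OF Q, of length] by blast
  moreover have "x = x'" if "?P x" "?P x'" for x x'
    using that normal_word_unique[of x x'] by (simp add: le_antisym)
  ultimately have P: "?P y"
    unfolding y_def NF_def by (intro theI[of ?P]) blast+
  have carr: "set y \<subseteq> carrier M"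
    using P lists_carrier by (auto simp: normal_word_def)
  have "length y \<le> length w" using P Q by blast
  moreover have "word_eval M (y @ replicate (length w - length y) \<one>) = word_eval M w"
    using P carr lists_carrier[OF one_pad_lists] lists_carrier[of w] assms(1)
    by (simp add: word_eval_append normal_word_def del: set_replicate)
  ultimately have "y @ replicate (length w - length y) \<one> = w"
    using P Q by (intro normal_word_unique normal_word_append_ones) auto
  with P show ?thesis by simp
qed

section \<open>The domino rule and normalisation in passes\<close>

text \<open>One step of the left-to-right pass: the letter \<open>r\<close> is final and
  \<open>g\<close> is carried on to the tail. Locality and the domino rule are hypotheses, since the
  two directions of the equivalence obtain them differently.\<close>

lemma N_Cons_normal:
  assumes local: "\<And>w. w \<in> lists S \<Longrightarrow> N w = w \<longleftrightarrow> successively (\<lambda>s t. N [s, t] = [s, t]) w"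
    and domino: "\<And>s t u r g. s \<in> S \<Longrightarrow> t \<in> S \<Longrightarrow> u \<in> S \<Longrightarrow> N [t, u] = [t, u] \<Longrightarrow> N [s, t] = [r, g]
      \<Longrightarrow> N [r, hd (N [g, u])] = [r, hd (N [g, u])]"
    and "s \<in> S" "b \<in> S" "w \<in> lists S" "N (b # w) = b # w" "N [s, b] = [r, g]"
  shows "N (s # b # w) = r # N (g # w)"
  using assms(3-)
proof (induction w arbitrary: s b r g)
  case Nil
  then have "g \<in> S" by (metis N_pair_obtain list.inject)
  with Nil show ?case by (simp add: N_letter)
next
  case (Cons c w)
  have S: "r \<in> S" "g \<in> S" "c \<in> S" "w \<in> lists S"
    using Cons.prems by (auto intro: N_pair_obtain[of s b])
  obtain r' g' where rg': "N [g, c] = [r', g']" "r' \<in> S" "g' \<in> S"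
    using S N_pair_obtain by metis
  have bc: "N [b, c] = [b, c]" "N (c # w) = c # w"
    using Cons.prems local[of "b # c # w"] local[of "c # w"] S by auto
  have eq: "N (g # c # w) = r' # N (g' # w)"
    using Cons.IH[of g c r' g'] S bc rg' by simp
  have "N [r, r'] = [r, r']"
    using domino[of s b c r g] Cons.prems bc rg' S by simp
  moreover have "successively (\<lambda>s t. N [s, t] = [s, t]) (r' # N (g' # w))"
    using local[of "N (g # c # w)"] S eq N_idem[of "g # c # w"] N_lists[of "g # c # w"] by simp
  ultimately have "successively (\<lambda>s t. N [s, t] = [s, t]) (r # N (g # c # w))"
    using eq by simp
  then have "N (r # N (g # c # w)) = r # N (g # c # w)"
    using local[of "r # N (g # c # w)"] S by simp
  then show ?case
    using N_Cons[of r "g # c # w"] N_pair_prefix[of s b "c # w" r g] Cons.prems S by simp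
qed

text \<open>Normalise the tail first, with all positions shifted by one, and then insert the first
  letter by one pass from left to right.\<close>

lemma N_eq_Nbar_seq:
  assumes cons: "\<And>s b w r g. s \<in> S \<Longrightarrow> b \<in> S \<Longrightarrow> w \<in> lists S \<Longrightarrow> N (b # w) = b # w
      \<Longrightarrow> N [s, b] = [r, g] \<Longrightarrow> N (s # b # w) = r # N (g # w)"
    and tail: "\<And>b w. b # w \<in> lists S \<Longrightarrow> N (b # w) = b # w \<Longrightarrow> N w = w"
    and "w \<in> lists S"
  shows "\<exists>is. (\<forall>i\<in>set is. 1 \<le> i \<and> i < length w) \<and> N w = Nbar_seq N is w"
  using assms(3)
proof (induction w rule: list.induct)
  case Nil
  then show ?case
    by (intro exI[of _ "[]"]) simp
next
  case (Cons a w)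
  \<comment> \<open>Here \<open>w\<close> is the tail, so \<open>i \<le> length w\<close> says that
    position \<open>i\<close> is admissible in \<open>a # w\<close>.\<close>
  have pass: "\<exists>is. (\<forall>i\<in>set is. 1 \<le> i \<and> i \<le> length w) \<and> N (a # w) = Nbar_seq N is (a # w)"
    if "a \<in> S" "w \<in> lists S" "N w = w" for a w
    using that
  proof (induction w arbitrary: a)
    case Nil
    then show ?case by (intro exI[of _ "[]"]) (simp add: N_letter)
  next
    case (Cons b w)
    obtain r g where rg: "N [a, b] = [r, g]" "r \<in> S" "g \<in> S"
      using Cons.prems N_pair_obtain by (metis listsE)
    obtain "is" where "is": "\<forall>i\<in>set is. 1 \<le> i \<and> i \<le> length w" "N (g # w) = Nbar_seq N is (g # w)"
      using Cons.IH[of g] Cons.prems tail[of b w] rg by auto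
    have "N (a # b # w) = r # Nbar_seq N is (g # w)"
      using cons[of a b w r g] rg "is" Cons.prems by simp
    also have "\<dots> = Nbar_seq N (1 # map Suc is) (a # b # w)"
      using "is" rg by (simp add: Nbar_1 Nbar_seq_map_Suc)
    finally show ?case
      using "is" by (intro exI[of _ "1 # map Suc is"]) auto
  qed
  obtain "is" where "is": "\<forall>i\<in>set is. 1 \<le> i \<and> i < length w" "N w = Nbar_seq N is w"
    using Cons by auto
  obtain js where js: "\<forall>i\<in>set js. 1 \<le> i \<and> i \<le> length w" "N (a # N w) = Nbar_seq N js (a # N w)"
    using pass[of a "N w"] Cons N_idem by auto
  have "N (a # w) = N (a # N w)"
    using Cons.prems by (simp add: N_Cons)
  also have "\<dots> = Nbar_seq N js (a # Nbar_seq N is w)"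
    using js(2) unfolding "is"(2) .
  also have "\<dots> = Nbar_seq N (map Suc is @ js) (a # w)"
    using "is"(1) by (simp add: Nbar_seq_append Nbar_seq_map_Suc)
  finally have "N (a # w) = Nbar_seq N (map Suc is @ js) (a # w)" .
  with "is"(1) js(1) show ?case
    by (intro exI[of _ "map Suc is @ js"]) auto
qed

section \<open>From Garside families to left-weighted class (4,3)\<close>

text \<open>A greedy word is determined by its length and value, so being fixed by \<open>N\<close>
  is the same as being greedy. Locality, the domino rule and left-weightedness then follow from
  greediness of pairs.\<close>

lemma garside_imp_quadratic:
  assumes garside: "garside_family M S"
    and derived: "\<forall>w\<in>lists S. N w = derived_normalisation M S w"
  shows "quadratic_class_4_3 S N \<and> left_weighted S N M"
proof -
  have N_normal: "normal_word M S (N w)" if w: "w \<in> lists S" for w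
  proof -
    obtain x where x: "normal_word M S x" "word_eval M x = word_eval M w"
      using garside lists_carrier[OF w] unfolding garside_family_def by (meson word_eval_closed)
    show ?thesis
      using NF_normal[OF x(1)] x(2) derived w
      by (auto simp: derived_normalisation_def normal_word_append_ones)
  qed
  have N_eq_iff: "N w = w \<longleftrightarrow> normal_word M S w" if w: "w \<in> lists S" for w
    using N_normal[OF w] normal_word_unique[of "N w" w] w word_eval_N[OF w] by auto
  have pair: "N [s, t] = [s, t] \<longleftrightarrow> normal_pair M S s t" if "s \<in> S" "t \<in> S" for s t
    using N_eq_iff[of "[s, t]"] that by (auto simp: normal_word_def)
  have local: "N w = w \<longleftrightarrow> successively (\<lambda>s t. N [s, t] = [s, t]) w" if "w \<in> lists S" for w
  proof -
    have "successively (normal_pair M S) w \<longleftrightarrow> successively (\<lambda>s t. N [s, t] = [s, t]) w"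
      using that by (intro successively_cong) (auto simp: pair)
    then show ?thesis using N_eq_iff[OF that] that by (simp add: normal_word_def)
  qed
  have pair_eval: "r \<otimes> g = s \<otimes> t" if "s \<in> S" "t \<in> S" "N [s, t] = [r, g]" for s t r g
    using word_eval_N[of "[s, t]"] N_lists[of "[s, t]"] that S_carrier by simp
  have pair_norm: "normal_pair M S r g" if "s \<in> S" "t \<in> S" "N [s, t] = [r, g]" for s t r g
    using N_normal[of "[s, t]"] that by (simp add: normal_word_def)
  have domino: "N [r, hd (N [g, u])] = [r, hd (N [g, u])]"
    if S: "s \<in> S" "t \<in> S" "u \<in> S" and tu: "N [t, u] = [t, u]" and rg: "N [s, t] = [r, g]"
    for s t u r g
  proof -
    have S': "r \<in> S" "g \<in> S" using S rg N_lists[of "[s, t]"] by auto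
    obtain c d where cd: "N [g, u] = [c, d]" "c \<in> S" "d \<in> S"
      using S' S N_pair_obtain by metis
    note carr = S[THEN S_carrier] S'[THEN S_carrier] cd(2,3)[THEN S_carrier]
    have "normal_pair M S r c"
      unfolding normal_pair_def
    proof (intro ballI impI)
      \<comment> \<open>A divisor of \<open>f \<otimes> r \<otimes> c\<close> divides
        \<open>f \<otimes> r \<otimes> c \<otimes> d\<close>, which equals
        \<open>f \<otimes> s \<otimes> t \<otimes> u\<close>. Normality of \<open>t\<close>,
        \<open>u\<close> removes \<open>u\<close>; after rewriting \<open>s \<otimes> t\<close> as
        \<open>r \<otimes> g\<close>, normality of \<open>r\<close>, \<open>g\<close> removes
        \<open>g\<close>.\<close>
      fix a f assume a: "a \<in> S" and f: "f \<in> carrier M" and "a divides f \<otimes> r \<otimes> c"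
      then have "a divides f \<otimes> r \<otimes> c \<otimes> d"
        using carr S_carrier[OF a] by (intro divides_prod_r[of a "f \<otimes> r \<otimes> c" d]) auto
      also have "f \<otimes> r \<otimes> c \<otimes> d = f \<otimes> r \<otimes> (g \<otimes> u)"
        using pair_eval[OF S'(2) S(3) cd(1)] f carr by (simp add: m_assoc)
      also have "\<dots> = f \<otimes> (r \<otimes> g) \<otimes> u"
        using f carr by (simp add: m_assoc)
      also have "\<dots> = (f \<otimes> s) \<otimes> t \<otimes> u"
        using pair_eval[OF S(1,2) rg] f carr by (simp add: m_assoc)
      finally have "a divides (f \<otimes> s) \<otimes> t"
        using tu pair[OF S(2,3)] a f carr unfolding normal_pair_def by blast
      also have "(f \<otimes> s) \<otimes> t = f \<otimes> r \<otimes> g"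
        using pair_eval[OF S(1,2) rg] f carr by (simp add: m_assoc)
      finally show "a divides f \<otimes> r"
        using pair_norm[OF S(1,2) rg] a f unfolding normal_pair_def by blast
    qed
    then show ?thesis using pair S' cd by simp
  qed
  have cons: "N (s # b # w) = r # N (g # w)"
    if "s \<in> S" "b \<in> S" "w \<in> lists S" "N (b # w) = b # w" "N [s, b] = [r, g]" for s b w r g
    by (rule N_Cons_normal[OF _ _ that]) (fact local, fact domino)
  have seq: "\<exists>is. (\<forall>i\<in>set is. 1 \<le> i \<and> i < length w) \<and> N w = Nbar_seq N is w" if "w \<in> lists S" for w
  proof (rule N_eq_Nbar_seq[OF _ _ that])
    show "N w = w" if "b # w \<in> lists S" "N (b # w) = b # w" for b w
      using that local[of "b # w"] local[of w] by (cases w) auto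
  qed (fact cons)
  have quad: "quadratic S N"
    unfolding quadratic_def using local seq by (simp add: successively_iff_factors)
  \<comment> \<open>Position 2 normalises the tail \<open>b\<close>, \<open>c\<close>; positions 1
    and 2 are then the pass of \<open>a\<close> through it.\<close>
  have N212: "N [a, b, c] = Nbar_seq N [2, 1, 2] [a, b, c]" if S: "a \<in> S" "b \<in> S" "c \<in> S" for a b c
  proof -
    obtain x y where xy: "N [b, c] = [x, y]" "x \<in> S" "y \<in> S"
      using S N_pair_obtain by metis
    obtain r g where rg: "N [a, x] = [r, g]" "r \<in> S" "g \<in> S"
      using S xy N_pair_obtain by metis
    have "N [a, b, c] = N [a, x, y]"
      using N_Cons[of a "[b, c]"] S xy by simp
    also have "\<dots> = r # N [g, y]"
      using cons[of a x "[y]" r g] S xy rg N_idem[of "[b, c]"] by simp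
    also have "\<dots> = Nbar_seq N [2, 1, 2] [a, b, c]"
      using xy rg by (simp add: Nbar_1 Nbar_Suc_Cons numeral_2_eq_2)
    finally show ?thesis .
  qed
  \<comment> \<open>The extra first step does not change the value of \<open>N\<close>, which
    reduces the claim to \<open>N212\<close>.\<close>
  have N1212: "N [a, b, c] = Nbar_seq N [1, 2, 1, 2] [a, b, c]" if S: "a \<in> S" "b \<in> S" "c \<in> S" for a b c
  proof -
    obtain x y where xy: "N [a, b] = [x, y]" "x \<in> S" "y \<in> S"
      using S N_pair_obtain by metis
    have "N [a, b, c] = N [x, y, c]"
      using N_pair_prefix[of a b "[c]"] S xy by simp
    then show ?thesis
      using N212[of x y c] S xy by (simp add: Nbar_1)
  qed
  have "quadratic_class_4_3 S N"
    unfolding quadratic_class_4_3_def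
    using quad N212 N1212 by (auto simp: numeral_3_eq_3 length_Suc_conv)
  moreover have "left_weighted S N M"
    unfolding left_weighted_def
  proof (intro ballI impI)
    fix s t s' t' assume S: "s \<in> S" "t \<in> S" "s' \<in> S" "t' \<in> S" and eq: "[s', t'] = N [s, t]"
    note carr = S[THEN S_carrier]
    have "s divides \<one> \<otimes> s' \<otimes> t'"
      using pair_eval[of s t s' t'] S eq carr by auto
    then have "s divides \<one> \<otimes> s'"
      using pair_norm[of s t s' t'] S eq unfolding normal_pair_def by auto
    then show "s divides s'" using carr by simp
  qed
  ultimately show ?thesis by blast
qed

section \<open>From left-weighted class (4,3) to Garside families\<close>

text \<open>Only position 1 can alter the first letter, and there left-weightedness applies.\<close>

lemma Nbar_head_divides:
  assumes lw: "left_weighted S N M" and "w \<in> lists S" "1 \<le> i" "i < length w"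
  shows "Nbar N i w \<in> lists S \<and> length (Nbar N i w) = length w \<and> hd w divides hd (Nbar N i w)"
  using assms(2-)
proof (induction w arbitrary: i rule: list.induct)
  case (Cons a w)
  show ?case
  proof (cases "i = 1")
    case True
    then obtain b v where w: "w = b # v" using Cons.prems by (cases w) auto
    obtain r g where rg: "N [a, b] = [r, g]" "r \<in> S" "g \<in> S"
      using Cons.prems w N_pair_obtain by (metis listsE)
    then have "a divides r"
      using lw Cons.prems w unfolding left_weighted_def by auto
    then show ?thesis using True w rg Cons.prems by (simp add: Nbar_1)
  next
    case False
    then obtain j where j: "i = Suc j" "1 \<le> j" using Cons.prems by (cases i) auto
    with Cons show ?thesis by (auto simp: Nbar_Suc_Cons S_carrier)
  qed
qed simp

lemma Nbar_seq_head_divides: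
  assumes lw: "left_weighted S N M"
    and "w \<in> lists S" "w \<noteq> []" "\<forall>i\<in>set is. 1 \<le> i \<and> i < length w"
  shows "Nbar_seq N is w \<in> lists S \<and> Nbar_seq N is w \<noteq> [] \<and> hd w divides hd (Nbar_seq N is w)"
  using assms(2-)
proof (induction "is" arbitrary: w)
  case Nil
  then have "hd w \<in> carrier M" by (cases w) (auto simp: S_carrier)
  with Nil show ?case by simp
next
  case (Cons i "is")
  note step = Nbar_head_divides[OF lw Cons.prems(1), of i]
  have ih: "Nbar_seq N is (Nbar N i w) \<in> lists S \<and> Nbar_seq N is (Nbar N i w) \<noteq> [] \<and>
    hd (Nbar N i w) divides hd (Nbar_seq N is (Nbar N i w))"
    using Cons step by (intro Cons.IH) auto
  have "hd w \<in> carrier M" using Cons.prems by (cases w) (auto simp: S_carrier)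
  with ih step Cons.prems show ?case
    by (auto intro: divides_trans)
qed

text \<open>Once pairs fixed by \<open>N\<close> are shown to be greedy, \<open>N w\<close> is a
  greedy word with the value and length of \<open>w\<close>, so it is \<open>NF\<close> padded by
  ones.\<close>

lemma quadratic_imp_garside:
  assumes class43: "quadratic_class_4_3 S N" and lw: "left_weighted S N M"
  shows "garside_family M S \<and> (\<forall>w\<in>lists S. N w = derived_normalisation M S w)"
proof -
  have local: "N w = w \<longleftrightarrow> successively (\<lambda>s t. N [s, t] = [s, t]) w" if "w \<in> lists S" for w
    using class43 that unfolding quadratic_class_4_3_def quadratic_def
    by (simp add: successively_iff_factors)
  have N212: "N w = Nbar_seq N [2, 1, 2] w" if "w \<in> lists S" "length w = 3" for w
    using class43 that unfolding quadratic_class_4_3_def by blast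
  have domino: "N [r, hd (N [g, u])] = [r, hd (N [g, u])]"
    if S: "s \<in> S" "t \<in> S" "u \<in> S" and tu: "N [t, u] = [t, u]" and rg: "N [s, t] = [r, g]"
    for s t u r g
  proof -
    have S': "r \<in> S" "g \<in> S" using S rg N_lists[of "[s, t]"] by auto
    obtain c d where cd: "N [g, u] = [c, d]"
      using S' S N_pair_obtain by metis
    \<comment> \<open>Since \<open>t\<close>, \<open>u\<close> is normal, the first step at position
      2 changes nothing, and positions 1 and 2 produce \<open>r\<close>, \<open>c\<close>,
      \<open>d\<close>. Normality of this word includes that of \<open>r\<close>,
      \<open>c\<close>.\<close>
    have "N [s, t, u] = [r, c, d]"
      using N212[of "[s, t, u]"] S tu rg cd by (simp add: Nbar_1 Nbar_Suc_Cons numeral_2_eq_2)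
    then show ?thesis
      using local[of "N [s, t, u]"] N_idem[of "[s, t, u]"] N_lists[of "[s, t, u]"] S cd by simp
  qed
  have cons: "N (s # b # w) = r # N (g # w)"
    if "s \<in> S" "b \<in> S" "w \<in> lists S" "N (b # w) = b # w" "N [s, b] = [r, g]" for s b w r g
    by (rule N_Cons_normal[OF _ _ that]) (fact local, fact domino)
  have head_Cons: "hd (N (s # w)) = hd (N [s, hd w])"
    if S: "s \<in> S" "w \<in> lists S" "w \<noteq> []" and "N w = w" for s w
  proof -
    obtain b v where w: "w = b # v" using S by (cases w) auto
    obtain r g where rg: "N [s, b] = [r, g]"
      using S w N_pair_obtain by (metis listsE)
    then show ?thesis using cons[of s b v r g] that w by simp
  qed
  have head_N_snoc: "hd (N (u @ [a, b])) = hd (N (u @ [a]))"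
    if "u \<in> lists S" "a \<in> S" "b \<in> S" "N [a, b] = [a, b]" for u a b
    using that
  proof (induction u rule: list.induct)
    case Nil
    then show ?case by (simp add: N_letter)
  next
    case (Cons s u)
    \<comment> \<open>The first letter of \<open>N (s # w)\<close> depends on \<open>w\<close> only
      through the first letter of \<open>N w\<close>, so equality of first letters propagates from
      \<open>u\<close> to \<open>s # u\<close>.\<close>
    have step: "hd (N (s # w)) = hd (N [s, hd (N w)])" if "w \<in> lists S" "w \<noteq> []" for w
    proof -
      have "N w \<noteq> []" using that by simp
      then show ?thesis
        using head_Cons[of s "N w"] N_Cons[of s w] N_idem[of w] that Cons.prems by simp
    qed
    show ?case
      using step[of "u @ [a, b]"] step[of "u @ [a]"] Cons by simp
  qed
  have divides_head: "s divides hd (N w)"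
    if S: "s \<in> S" "w \<in> lists S" "w \<noteq> []" and "s divides word_eval M w" for s w
  proof -
    obtain h where h: "h \<in> carrier M" "word_eval M w = s \<otimes> h"
      using \<open>s divides word_eval M w\<close> by (auto simp: factor_def)
    obtain v where v: "v \<in> lists S" "word_eval M v = h"
      using word_eval_surj h(1) by blast
    \<comment> \<open>The words \<open>w\<close> and \<open>s # v\<close> have the same value, so
      their normal forms differ only by trailing ones. Being nonempty, they share the first letter,
      and along the rewriting of \<open>s # v\<close> that letter stays a multiple of
      \<open>s\<close>.\<close>
    obtain m n where mn: "N w @ replicate m \<one> = N (s # v) @ replicate n \<one>"
      using word_eval_eq_imp_N_eq[of w "s # v"] S v h by auto
    have "N w \<noteq> []" "N (s # v) \<noteq> []"
      using S v by simp_all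
    with mn have "hd (N w) = hd (N (s # v))"
      by (metis hd_append2)
    moreover obtain "is" where "\<forall>i\<in>set is. 1 \<le> i \<and> i < length (s # v)" "N (s # v) = Nbar_seq N is (s # v)"
      using class43 S v unfolding quadratic_class_4_3_def quadratic_def by (meson Cons_in_lists_iff)
    ultimately show ?thesis
      using Nbar_seq_head_divides[OF lw, of "s # v" "is"] S v by simp
  qed
  have greedy: "normal_pair M S a b" if S: "a \<in> S" "b \<in> S" and ab: "N [a, b] = [a, b]" for a b
    unfolding normal_pair_def
  proof (intro ballI impI)
    fix s f assume s: "s \<in> S" and f: "f \<in> carrier M" and div: "s divides f \<otimes> a \<otimes> b"
    note carr = S[THEN S_carrier]
    obtain u where u: "u \<in> lists S" "word_eval M u = f"
      using word_eval_surj f by blast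
    note u_carr = lists_carrier[OF u(1)]
    have "word_eval M (u @ [a, b]) = f \<otimes> a \<otimes> b"
      using u u_carr carr f by (simp add: word_eval_append m_assoc)
    then have "s divides hd (N (u @ [a, b]))"
      using divides_head[of s "u @ [a, b]"] s S u div by simp
    then have head: "s divides hd (N (u @ [a]))"
      using head_N_snoc[OF u(1) S ab] by simp
    have ua: "u @ [a] \<in> lists S" using u S by simp
    have "N (u @ [a]) \<noteq> []" using ua by simp
    then obtain c v where cv: "N (u @ [a]) = c # v" by (cases "N (u @ [a])") auto
    then have cv_S: "c \<in> carrier M" "set v \<subseteq> carrier M"
      using N_lists[OF ua] S_carrier by auto
    \<comment> \<open>The first letter \<open>c\<close> of \<open>N (u @ [a])\<close> left-divides
      the value \<open>f \<otimes> a\<close>, so \<open>s\<close> does too.\<close>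
    have "c \<otimes> word_eval M v = f \<otimes> a"
      using word_eval_N[OF ua] cv u u_carr carr f by (simp add: word_eval_append)
    moreover have "s divides c \<otimes> word_eval M v"
      using head cv cv_S S_carrier[OF s] by (intro divides_prod_r[of s c "word_eval M v"]) auto
    ultimately show "s divides f \<otimes> a" by simp
  qed
  have normal: "normal_word M S (N w)" if w: "w \<in> lists S" for w
  proof -
    have "successively (\<lambda>s t. N [s, t] = [s, t]) (N w)"
      using local[of "N w"] w N_idem by simp
    then have "successively (normal_pair M S) (N w)"
      using N_lists[OF w] by (elim successively_mono) (auto intro!: greedy)
    then show ?thesis using w by (simp add: normal_word_def)
  qed
  have "garside_family M S"
    unfolding garside_family_def
    using S_carrier normal word_eval_N word_eval_surj by (metis one_S subsetI)
  moreover have "N w = derived_normalisation M S w" if "w \<in> lists S" for w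
    using NF_normal[OF normal[OF that]] that by (simp add: derived_normalisation_def word_eval_N)
  ultimately show ?thesis by blast
qed

end

theorem theoremC:
  fixes M :: "('a, 'b) monoid_scheme" and S :: "'a set" and N :: "'a list \<Rightarrow> 'a list"
  assumes "monoid M"
    and "normalisation_mod S N \<one>\<^bsub>M\<^esub> M"
    and "left_cancellative M"
    and "Units M = {\<one>\<^bsub>M\<^esub>}"
  shows "(garside_family M S \<and> (\<forall>w\<in>lists S. N w = derived_normalisation M S w)) \<longleftrightarrow>
         (quadratic_class_4_3 S N \<and> left_weighted S N M)"
proof -
  interpret monoid M by fact
  interpret cancellative_normalisation M S N
    by unfold_locales fact+
  show ?thesis
    using garside_imp_quadratic quadratic_imp_garside by blast
qed

end
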